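(* Consider the standard voter model in the dynamic graph model, with $\kappa \le n$ opinions arbitrarily distributed over the nodes of $G_1$, and let $\phi_t$ be a lower bound on the conductance of $G_t$ for every round $t$. There is a suitably chosen constant $b>0$ such that, with probability at least $1/2$, the consensus time satisfies $T \le \min\{\tau,\tau'\}$, where (i) $\tau$ is the first round such that $\sum_{t=1}^{\tau}\phi_t \ge b\cdot m/d_{\min}$, and (ii) $\tau'$ is the first round such that $\sum_{t=1}^{\tau'}\phi_t^2 \ge b\cdot n\log n$. In particular, for static graphs ($G_{i+1}=G_i$ for all $i$) of conductance $\phi$, with probability at least $1/2$ we have $T = O\big(\min\{m/(d_{\min}\phi),\ n\log n/\phi^2\}\big)$.
   Context: Graphs are undirected and connected on the vertex set $V=\{1,\dots,n\}$; $d_u$ denotes the degree of $u$, $d_{\min}$ the minimum degree, $m$ the number of edges, and $\mathrm{vol}(U)=\sum_{u\in U}d_u$. For $U\subseteq V$ and $u\in U$ let $\lambda_u$ be the number of neighbours of $u$ in $V\setminus U$. The conductance of $G$ is $\phi(G)=\min\{\sum_{u\in U}\lambda_u/\mathrm{vol}(U) : U\subset V,\ 0<\mathrm{vol}(U)\le m\}$. Dynamic graph model: a sequence of graphs $G_1,G_2,\dots$ on the common vertex set $V$ is generated by an adversary. A degree sequence $d_1,\dots,d_n$ and a sequence of conductance bounds $\phi_1,\phi_2,\dots$ are fixed in advance (not random); the adversary may redistribute the edges in every round, knowing the opinions of all nodes in all previous rounds, subject to node $j$ having degree $d_j$ in every $G_t$ and $G_t$ having conductance at least $\phi_t$. Standard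 voter model: every node initially holds an opinion; in each synchronous round $t$, every node independently chooses a neighbour in $G_t$ uniformly at random and, with probability $1/2$, adopts that neighbour's opinion (as held at the beginning of the round), otherwise it keeps its opinion. The consensus time $T$ is the first round after which all nodes hold the same opinion. Logarithms are natural or base 2 (only constants change). *)

theory Defs
  imports "HOL-Probability.Probability"
begin

definition verts :: "nat \<Rightarrow> nat set" where
  "verts n = {1..n}"

definition is_graph :: "nat \<Rightarrow> (nat \<Rightarrow> nat \<Rightarrow> bool) \<Rightarrow> bool" where
  "is_graph n E \<longleftrightarrow> (\<forall>u v. E u v \<longrightarrow> u \<in> verts n \<and> v \<in> verts n \<and> u \<noteq> v \<and> E v u)"

definition connected_graph :: "nat \<Rightarrow> (nat \<Rightarrow> nat \<Rightarrow> bool) \<Rightarrow> bool" where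
  "connected_graph n E \<longleftrightarrow> (\<forall>u\<in>verts n. \<forall>v\<in>verts n. E\<^sup>*\<^sup>* u v)"

definition nbrs :: "nat \<Rightarrow> (nat \<Rightarrow> nat \<Rightarrow> bool) \<Rightarrow> nat \<Rightarrow> nat set" where
  "nbrs n E u = {v \<in> verts n. E u v}"

definition deg :: "nat \<Rightarrow> (nat \<Rightarrow> nat \<Rightarrow> bool) \<Rightarrow> nat \<Rightarrow> nat" where
  "deg n E u = card (nbrs n E u)"

definition num_edges :: "nat \<Rightarrow> (nat \<Rightarrow> nat \<Rightarrow> bool) \<Rightarrow> nat" where
  "num_edges n E = card {{u, v} | u v. u \<in> verts n \<and> v \<in> verts n \<and> E u v}"

definition vol :: "nat \<Rightarrow> (nat \<Rightarrow> nat \<Rightarrow> bool) \<Rightarrow> nat set \<Rightarrow> nat" where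
  "vol n E U = (\<Sum>u\<in>U. deg n E u)"

definition out_nbrs :: "nat \<Rightarrow> (nat \<Rightarrow> nat \<Rightarrow> bool) \<Rightarrow> nat set \<Rightarrow> nat \<Rightarrow> nat" where
  "out_nbrs n E U u = card {v \<in> verts n - U. E u v}"

definition conductance :: "nat \<Rightarrow> (nat \<Rightarrow> nat \<Rightarrow> bool) \<Rightarrow> real" where
  "conductance n E = Min {real (\<Sum>u\<in>U. out_nbrs n E U u) / real (vol n E U) | U.
      U \<subset> verts n \<and> 0 < vol n E U \<and> vol n E U \<le> num_edges n E}"

definition node_update :: "nat \<Rightarrow> (nat \<Rightarrow> nat \<Rightarrow> bool) \<Rightarrow> (nat \<Rightarrow> nat) \<Rightarrow> nat \<Rightarrow> nat pmf" where
  "node_update n E c u =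
     (if nbrs n E u = {} then return_pmf (c u)
      else do { b \<leftarrow> bernoulli_pmf (1/2);
                if b then map_pmf c (pmf_of_set (nbrs n E u)) else return_pmf (c u) })"

definition voter_step :: "nat \<Rightarrow> (nat \<Rightarrow> nat \<Rightarrow> bool) \<Rightarrow> (nat \<Rightarrow> nat) \<Rightarrow> (nat \<Rightarrow> nat) pmf" where
  "voter_step n E c = Pi_pmf (verts n) 0 (node_update n E c)"

text \<open>Adversary: maps the history of opinion configurations (the configurations at the
  beginning of rounds 1..t, i.e. a list of length t) to the graph G_t used in round t.
  hist t is the distribution of the history after t rounds: a list of length t+1 whose
  i-th entry is the configuration after i rounds (entry 0 is the initial one).\<close>

primrec voter_hist :: "nat \<Rightarrow> ((nat \<Rightarrow> nat) list \<Rightarrow> (nat \<Rightarrow> nat \<Rightarrow> bool)) \<Rightarrow> (nat \<Rightarrow> nat)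
    \<Rightarrow> nat \<Rightarrow> (nat \<Rightarrow> nat) list pmf" where
  "voter_hist n adv c0 0 = return_pmf [c0]"
| "voter_hist n adv c0 (Suc t) =
     bind_pmf (voter_hist n adv c0 t) (\<lambda>h. map_pmf (\<lambda>c. h @ [c]) (voter_step n (adv h) (last h)))"

definition consensus :: "nat \<Rightarrow> (nat \<Rightarrow> nat) \<Rightarrow> bool" where
  "consensus n c \<longleftrightarrow> (\<forall>u\<in>verts n. \<forall>v\<in>verts n. c u = c v)"

text \<open>Event "T <= k" on a history of length k+1.\<close>
definition consensus_by :: "nat \<Rightarrow> nat \<Rightarrow> (nat \<Rightarrow> nat) list \<Rightarrow> bool" where
  "consensus_by n k h \<longleftrightarrow> (\<exists>i\<le>k. consensus n (h ! i))"

definition admissible_adversary :: "nat \<Rightarrow> (nat \<Rightarrow> nat) \<Rightarrow> (nat \<Rightarrow> real)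
    \<Rightarrow> ((nat \<Rightarrow> nat) list \<Rightarrow> (nat \<Rightarrow> nat \<Rightarrow> bool)) \<Rightarrow> bool" where
  "admissible_adversary n d \<phi> adv \<longleftrightarrow>
     (\<forall>h. length h \<ge> 1 \<longrightarrow>
        is_graph n (adv h) \<and> connected_graph n (adv h) \<and>
        (\<forall>j\<in>verts n. deg n (adv h) j = d j) \<and>
        conductance n (adv h) \<ge> \<phi> (length h))"

end

theory Submission
  imports Defs
begin

text \<open>
  Let \<open>V\<^sub>a\<close> be the total degree of the nodes holding opinion \<open>a\<close>, \<open>W = 2m\<close> and
  \<open>\<Phi> = (\<Sum>a. sqrt (V\<^sub>a / W)) \<ge> 1\<close>, with equality exactly at consensus. Each \<open>V\<^sub>a\<close> is a martingale, so
  \<open>\<Phi>\<close> is a supermartingale, and its drift is governed by the variance of the round. For the set \<open>S\<close> of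
  supporters of \<open>a\<close>, Jensen's inequality averages out the nodes outside \<open>S\<close>; a node of \<open>S\<close> keeps its
  opinion with probability at least 1/2, so the contributions of \<open>S\<close> have nonpositive third central
  moment and \<open>sqrt (1 + x) \<le> 1 + x/2 - x\<^sup>2/8 + x\<^sup>3/16\<close> yields
  \<open>E (sqrt V'\<^sub>a) \<le> sqrt V\<^sub>a (1 - D\<^sub>a / (32 V\<^sub>a\<^sup>2))\<close> with \<open>D\<^sub>a = (\<Sum>u\<in>S. d\<^sub>u \<lambda>\<^sub>u)\<close>.

  If \<open>V\<^sub>a \<le> m\<close>, conductance gives \<open>D\<^sub>a \<ge> d\<^sub>m\<^sub>i\<^sub>n \<phi> V\<^sub>a\<close>, and, as \<open>\<lambda>\<^sub>u \<le> d\<^sub>u\<close>, Cauchy-Schwarz gives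
  \<open>D\<^sub>a \<ge> \<phi>\<^sup>2 V\<^sub>a\<^sup>2 / n\<close>. Without consensus, \<open>\<Phi>\<^sup>2\<close> is at most the number of live opinions, hence at most twice
  the number of live opinions with \<open>V\<^sub>a \<le> m\<close>, so the first bound makes the bounded quantity \<open>-1/\<Phi>\<close> drop
  by \<open>d\<^sub>m\<^sub>i\<^sub>n \<phi> / (64 W)\<close> in expectation; this gives (i) for any number of opinions without a union bound.
  The second bound contracts \<open>\<Phi> - 1\<close> by \<open>1 - \<phi>\<^sup>2 / (32 n)\<close>, and \<open>1 / (4n) \<le> \<Phi> - 1 \<le> n\<close> before
  consensus, so Markov's inequality gives (ii).
\<close>

subsection \<open>Finitely supported probability mass functions\<close>

lemma expectation_bind_pmf_finite:
  fixes h :: "'b \<Rightarrow> real"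
  assumes "finite (set_pmf p)" "\<And>x. x \<in> set_pmf p \<Longrightarrow> finite (set_pmf (f x))"
  shows "measure_pmf.expectation (bind_pmf p f) h =
    measure_pmf.expectation p (\<lambda>x. measure_pmf.expectation (f x) h)"
proof -
  have "measure_pmf.expectation (bind_pmf p f) h =
      (\<Sum>a\<in>set_pmf p. pmf p a *\<^sub>R measure_pmf.expectation (f a) h)"
    by (rule pmf_expectation_bind) (use assms in auto)
  also have "\<dots> = measure_pmf.expectation p (\<lambda>x. measure_pmf.expectation (f x) h)"
    by (rule integral_measure_pmf[symmetric]) (use assms in auto)
  finally show ?thesis .
qed

lemma expectation_pair_pmf_finite:
  fixes h :: "'a \<times> 'b \<Rightarrow> real"
  assumes "finite (set_pmf p)" "finite (set_pmf q)"
  shows "measure_pmf.expectation (pair_pmf p q) h =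
    measure_pmf.expectation p (\<lambda>x. measure_pmf.expectation q (\<lambda>y. h (x, y)))"
  unfolding pair_pmf_def using assms by (simp add: expectation_bind_pmf_finite)

lemma finite_set_Pi_pmf:
  assumes "finite A" "\<And>x. x \<in> A \<Longrightarrow> finite (set_pmf (p x))"
  shows "finite (set_pmf (Pi_pmf A dflt p))"
  using assms by (auto simp: set_Pi_pmf)

lemma expectation_mono_pmf_finite:
  fixes f g :: "'a \<Rightarrow> real"
  assumes "finite (set_pmf p)" "\<And>x. x \<in> set_pmf p \<Longrightarrow> f x \<le> g x"
  shows "measure_pmf.expectation p f \<le> measure_pmf.expectation p g"
  by (intro integral_mono_AE integrable_measure_pmf_finite assms(1))
     (auto simp: AE_measure_pmf_iff assms(2))

text \<open>Up to order three, every mixed term of the expansion contains a centred factor to the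
  first power, so by independence the moments add up. All claims share one induction because the
  higher moments use the vanishing mean of the remaining sum.\<close>

lemma moments_sum_Pi_pmf:
  fixes g :: "'a \<Rightarrow> 'b \<Rightarrow> real"
  assumes "finite A" "\<And>x. x \<in> A \<Longrightarrow> finite (set_pmf (p x))"
    and "\<And>x. x \<in> A \<Longrightarrow> measure_pmf.expectation (p x) (g x) = 0"
  shows "measure_pmf.expectation (Pi_pmf A dflt p) (\<lambda>f. \<Sum>x\<in>A. g x (f x)) = 0 \<and>
    measure_pmf.expectation (Pi_pmf A dflt p) (\<lambda>f. (\<Sum>x\<in>A. g x (f x))\<^sup>2) =
      (\<Sum>x\<in>A. measure_pmf.expectation (p x) (\<lambda>y. (g x y)\<^sup>2)) \<and>
    measure_pmf.expectation (Pi_pmf A dflt p) (\<lambda>f. (\<Sum>x\<in>A. g x (f x)) ^ 3) =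
      (\<Sum>x\<in>A. measure_pmf.expectation (p x) (\<lambda>y. (g x y) ^ 3))"
  using assms
proof (induction A rule: finite_induct)
  case empty
  then show ?case by simp
next
  case (insert x A)
  let ?P = "Pi_pmf A dflt p" and ?S = "\<lambda>f. \<Sum>x\<in>A. g x (f x)"
  have fp: "finite (set_pmf (p x))" and fP: "finite (set_pmf ?P)"
    using insert by (auto intro: finite_set_Pi_pmf)
  note int [simp] = integrable_measure_pmf_finite[OF fp] integrable_measure_pmf_finite[OF fP]
  have IH: "measure_pmf.expectation ?P ?S = 0"
    "measure_pmf.expectation ?P (\<lambda>f. (?S f)\<^sup>2) = (\<Sum>x\<in>A. measure_pmf.expectation (p x) (\<lambda>y. (g x y)\<^sup>2))"
    "measure_pmf.expectation ?P (\<lambda>f. (?S f) ^ 3) = (\<Sum>x\<in>A. measure_pmf.expectation (p x) (\<lambda>y. (g x y) ^ 3))"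
    using insert by auto
  have gx: "measure_pmf.expectation (p x) (g x) = 0"
    using insert by auto
  \<comment> \<open>A generic \<open>F\<close> splits off the coordinate \<open>x\<close> once for
    all three powers.\<close>
  have *: "measure_pmf.expectation (Pi_pmf (insert x A) dflt p) (\<lambda>f. F (\<Sum>z\<in>insert x A. g z (f z))) =
      measure_pmf.expectation (p x) (\<lambda>y. measure_pmf.expectation ?P (\<lambda>f. F (g x y + ?S f)))"
    for F :: "real \<Rightarrow> real"
  proof -
    have "(\<Sum>z\<in>A. g z ((f(x := y)) z)) = ?S f" for f y
      using insert.hyps by (intro sum.cong) auto
    then show ?thesis
      using insert.hyps
      by (simp add: Pi_pmf_insert case_prod_unfold expectation_pair_pmf_finite[OF fp fP])
  qed
  have 2: "(a + b)\<^sup>2 = a\<^sup>2 + 2 * a * b + b\<^sup>2"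
    and 3: "(a + b) ^ 3 = a ^ 3 + 3 * a\<^sup>2 * b + 3 * a * b\<^sup>2 + b ^ 3" for a b :: real
    by (auto simp: power2_eq_square power3_eq_cube algebra_simps)
  show ?case
    using insert.hyps
    unfolding *[of "\<lambda>s. s"] *[of "\<lambda>s. s\<^sup>2"] *[of "\<lambda>s. s ^ 3"]
    by (simp add: 2 3 IH gx)
qed

section \<open>Expected square root of a sum of independent variables\<close>

lemma expectation_sqrt_le_sqrt_expectation:
  fixes f :: "'a \<Rightarrow> real"
  assumes fin: "finite (set_pmf p)" and "\<And>x. x \<in> set_pmf p \<Longrightarrow> f x \<ge> 0"
  shows "measure_pmf.expectation p (\<lambda>x. sqrt (f x)) \<le> sqrt (measure_pmf.expectation p f)"
proof (rule real_le_rsqrt)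
  note [simp] = integrable_measure_pmf_finite[OF fin]
  \<comment> \<open>Jensen's inequality for the root amounts to a nonnegative variance of
    \<open>sqrt (f x)\<close>.\<close>
  have "0 \<le> measure_pmf.variance p (\<lambda>x. sqrt (f x))"
    by (rule measure_pmf.variance_positive)
  also have "\<dots> = measure_pmf.expectation p (\<lambda>x. (sqrt (f x))\<^sup>2) -
      (measure_pmf.expectation p (\<lambda>x. sqrt (f x)))\<^sup>2"
    by (rule measure_pmf.variance_eq) auto
  also have "measure_pmf.expectation p (\<lambda>x. (sqrt (f x))\<^sup>2) = measure_pmf.expectation p f"
    by (intro integral_cong_AE) (auto simp: AE_measure_pmf_iff assms)
  finally show "(measure_pmf.expectation p (\<lambda>x. sqrt (f x)))\<^sup>2 \<le> measure_pmf.expectation p f"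
    by simp
qed

text \<open>The right-hand side is the cubic Taylor polynomial at 0. In terms of
  \<open>s = sqrt (1 + x)\<close> its excess over the root is \<open>(s - 1) ^ 4\<close> times a
  positive quadratic, so the bound holds on the whole domain and not only near 0.\<close>

lemma sqrt_one_plus_le_cubic:
  fixes x :: real
  assumes "x \<ge> -1"
  shows "sqrt (1 + x) \<le> 1 + x / 2 - x\<^sup>2 / 8 + x ^ 3 / 16"
proof -
  define s where "s = sqrt (1 + x)"
  have s: "s \<ge> 0" "x = s\<^sup>2 - 1"
    using assms by (auto simp: s_def)
  have "1 + x / 2 - x\<^sup>2 / 8 + x ^ 3 / 16 - s = (s - 1) ^ 4 * (s\<^sup>2 + 4 * s + 5) / 16"
    unfolding s(2) by (simp add: field_simps eval_nat_numeral)
  also have "\<dots> \<ge> 0"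
    using s(1) by auto
  finally show ?thesis
    by (simp add: s_def)
qed

text \<open>Only the coordinates in \<open>B\<close> keep their fluctuations; the others enter
  through their mean. Expanding the root around \<open>M\<close> kills the linear term, turns the
  quadratic one into the variance of the \<open>B\<close> part, and leaves a cubic term that
  \<open>skew\<close> makes nonpositive.\<close>

lemma expectation_sqrt_sum_Pi_pmf_le:
  fixes g :: "'a \<Rightarrow> 'b \<Rightarrow> real" and p :: "'a \<Rightarrow> 'b pmf"
  defines "\<mu> \<equiv> \<lambda>x. measure_pmf.expectation (p x) (g x)"
  assumes fin: "finite A" and BA: "B \<subseteq> A" and finp: "\<And>x. x \<in> A \<Longrightarrow> finite (set_pmf (p x))"
    and nonneg: "\<And>x y. x \<in> A \<Longrightarrow> g x y \<ge> 0"
    and skew: "\<And>x. x \<in> B \<Longrightarrow> measure_pmf.expectation (p x) (\<lambda>y. (g x y - \<mu> x) ^ 3) \<le> 0"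
    and M: "M = (\<Sum>x\<in>A. \<mu> x)"
  shows "measure_pmf.expectation (Pi_pmf A dflt p) (\<lambda>f. sqrt (\<Sum>x\<in>A. g x (f x))) \<le>
    sqrt M * (1 - (\<Sum>x\<in>B. measure_pmf.expectation (p x) (\<lambda>y. (g x y - \<mu> x)\<^sup>2)) / (8 * M\<^sup>2))"
proof -
  define C where "C = A - B"
  have finB: "finite B" and finC: "finite C" and disj: "B \<inter> C = {}" and A: "A = B \<union> C"
    using fin BA finite_subset by (auto simp: C_def)
  let ?PB = "Pi_pmf B dflt p" and ?PC = "Pi_pmf C dflt p"
  have fPB: "finite (set_pmf ?PB)" and fPC: "finite (set_pmf ?PC)"
    using finB finC finp A by (auto intro!: finite_set_Pi_pmf)
  note [simp] = integrable_measure_pmf_finite[OF fPB] integrable_measure_pmf_finite[OF fPC]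
  have mu_nonneg: "\<mu> x \<ge> 0" if "x \<in> A" for x
    unfolding \<mu>_def using nonneg that by (intro Bochner_Integration.integral_nonneg) auto
  define MC where "MC = (\<Sum>x\<in>C. \<mu> x)"
  have M_split: "M = (\<Sum>x\<in>B. \<mu> x) + MC"
    unfolding M A MC_def using finB finC disj by (simp add: sum.union_disjoint)
  have MC0: "MC \<ge> 0" and M0: "M \<ge> 0"
    using mu_nonneg A by (auto simp: MC_def M intro!: sum_nonneg)
  have EC: "measure_pmf.expectation ?PC (\<lambda>f. \<Sum>x\<in>C. g x (f x)) = MC"
  proof -
    have "measure_pmf.expectation ?PC (\<lambda>f. g x (f x)) = \<mu> x" if "x \<in> C" for x
    proof -
      have "measure_pmf.expectation (map_pmf (\<lambda>f. f x) ?PC) (g x) = \<mu> x"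
        using that finC by (simp add: Pi_pmf_component \<mu>_def)
      then show ?thesis by simp
    qed
    then show ?thesis
      by (simp add: MC_def)
  qed
  have "measure_pmf.expectation (Pi_pmf A dflt p) (\<lambda>f. sqrt (\<Sum>x\<in>A. g x (f x))) =
     measure_pmf.expectation ?PB (\<lambda>f. measure_pmf.expectation ?PC
        (\<lambda>h. sqrt (\<Sum>x\<in>A. g x (if x \<in> B then f x else h x))))"
    unfolding A Pi_pmf_union[OF finB finC disj]
    by (simp add: case_prod_unfold expectation_pair_pmf_finite[OF fPB fPC] cong: if_cong)
  also have "\<dots> = measure_pmf.expectation ?PB (\<lambda>f. measure_pmf.expectation ?PC
        (\<lambda>h. sqrt ((\<Sum>x\<in>B. g x (f x)) + (\<Sum>x\<in>C. g x (h x)))))"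
  proof -
    have "(\<Sum>x\<in>A. g x (if x \<in> B then f x else h x)) = (\<Sum>x\<in>B. g x (f x)) + (\<Sum>x\<in>C. g x (h x))" for f h
      unfolding A sum.union_disjoint[OF finB finC disj]
      by (intro arg_cong2[where f = "(+)"] sum.cong) (use disj in auto)
    then show ?thesis by simp
  qed
  \<comment> \<open>For fixed values on \<open>B\<close>, Jensen's inequality replaces the
    coordinates in \<open>C\<close> by their mean \<open>MC\<close>.\<close>
  also have "\<dots> \<le> measure_pmf.expectation ?PB (\<lambda>f. sqrt ((\<Sum>x\<in>B. g x (f x)) + MC))"
  proof (rule expectation_mono_pmf_finite[OF fPB])
    fix f
    have "measure_pmf.expectation ?PC (\<lambda>h. sqrt ((\<Sum>x\<in>B. g x (f x)) + (\<Sum>x\<in>C. g x (h x)))) \<le>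
      sqrt (measure_pmf.expectation ?PC (\<lambda>h. (\<Sum>x\<in>B. g x (f x)) + (\<Sum>x\<in>C. g x (h x))))"
      by (rule expectation_sqrt_le_sqrt_expectation[OF fPC])
         (use nonneg A in \<open>auto intro!: add_nonneg_nonneg sum_nonneg\<close>)
    also have "\<dots> = sqrt ((\<Sum>x\<in>B. g x (f x)) + MC)"
      by (subst Bochner_Integration.integral_add) (simp_all only: EC, auto)
    finally show "measure_pmf.expectation ?PC (\<lambda>h. sqrt ((\<Sum>x\<in>B. g x (f x)) + (\<Sum>x\<in>C. g x (h x))))
      \<le> sqrt ((\<Sum>x\<in>B. g x (f x)) + MC)" .
  qed
  also have "\<dots> \<le> sqrt M * (1 - (\<Sum>x\<in>B. measure_pmf.expectation (p x) (\<lambda>y. (g x y - \<mu> x)\<^sup>2)) / (8 * M\<^sup>2))"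
  proof (cases "M = 0")
    \<comment> \<open>The expansion divides by \<open>M\<close>. For \<open>M = 0\<close> the factor
      \<open>sqrt M\<close> makes the claimed bound 0, and Jensen's inequality on \<open>B\<close>
      reaches it.\<close>
    case True
    have EB: "measure_pmf.expectation ?PB (\<lambda>f. g x (f x)) = \<mu> x" if "x \<in> B" for x
    proof -
      have "measure_pmf.expectation (map_pmf (\<lambda>f. f x) ?PB) (g x) = \<mu> x"
        using that finB by (simp add: Pi_pmf_component \<mu>_def)
      then show ?thesis by simp
    qed
    have "measure_pmf.expectation ?PB (\<lambda>f. sqrt ((\<Sum>x\<in>B. g x (f x)) + MC)) \<le>
      sqrt (measure_pmf.expectation ?PB (\<lambda>f. (\<Sum>x\<in>B. g x (f x)) + MC))"
      by (rule expectation_sqrt_le_sqrt_expectation[OF fPB])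
         (use nonneg A MC0 in \<open>auto intro!: add_nonneg_nonneg sum_nonneg\<close>)
    also have "measure_pmf.expectation ?PB (\<lambda>f. (\<Sum>x\<in>B. g x (f x)) + MC) = M"
      by (simp add: EB M_split)
    finally show ?thesis using True by simp
  next
    case False
    with M0 have Mpos: "M > 0" by simp
    define X where "X = (\<lambda>f. \<Sum>x\<in>B. g x (f x) - \<mu> x)"
    have mom: "measure_pmf.expectation ?PB X = 0"
      "measure_pmf.expectation ?PB (\<lambda>f. (X f)\<^sup>2) =
         (\<Sum>x\<in>B. measure_pmf.expectation (p x) (\<lambda>y. (g x y - \<mu> x)\<^sup>2))"
      "measure_pmf.expectation ?PB (\<lambda>f. (X f) ^ 3) =
         (\<Sum>x\<in>B. measure_pmf.expectation (p x) (\<lambda>y. (g x y - \<mu> x) ^ 3))"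
      using moments_sum_Pi_pmf[of B p "\<lambda>x y. g x y - \<mu> x" dflt] finB finp A
      by (auto simp: X_def \<mu>_def integrable_measure_pmf_finite)
    \<comment> \<open>The relative deviation \<open>X f / M\<close> is the argument of the cubic
      bound; it is at least -1 because the total is nonnegative.\<close>
    have eq: "(\<Sum>x\<in>B. g x (f x)) + MC = M * (1 + X f / M)" for f
      using Mpos by (simp add: X_def sum_subtractf M_split field_simps)
    have "measure_pmf.expectation ?PB (\<lambda>f. sqrt ((\<Sum>x\<in>B. g x (f x)) + MC)) \<le>
      measure_pmf.expectation ?PB (\<lambda>f. sqrt M * (1 + (X f / M) / 2 - (X f / M)\<^sup>2 / 8 + (X f / M) ^ 3 / 16))"
    proof (rule expectation_mono_pmf_finite[OF fPB])
      fix f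
      have "0 \<le> (\<Sum>x\<in>B. g x (f x)) + MC"
        using nonneg A MC0 by (auto intro!: add_nonneg_nonneg sum_nonneg)
      then have "X f / M \<ge> -1"
        using Mpos unfolding eq by (simp add: zero_le_mult_iff)
      from sqrt_one_plus_le_cubic[OF this]
      show "sqrt ((\<Sum>x\<in>B. g x (f x)) + MC) \<le>
        sqrt M * (1 + (X f / M) / 2 - (X f / M)\<^sup>2 / 8 + (X f / M) ^ 3 / 16)"
        unfolding eq real_sqrt_mult using Mpos by (intro mult_left_mono) auto
    qed
    also have "\<dots> = sqrt M * (1 - measure_pmf.expectation ?PB (\<lambda>f. (X f)\<^sup>2) / (8 * M\<^sup>2) +
        measure_pmf.expectation ?PB (\<lambda>f. (X f) ^ 3) / (16 * M ^ 3))"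
      by (simp add: power_divide mom(1) mult.commute)
    also have "\<dots> \<le> sqrt M * (1 - measure_pmf.expectation ?PB (\<lambda>f. (X f)\<^sup>2) / (8 * M\<^sup>2))"
    proof -
      have "measure_pmf.expectation ?PB (\<lambda>f. (X f) ^ 3) \<le> 0"
        unfolding mom by (rule sum_nonpos) (rule skew)
      then have "measure_pmf.expectation ?PB (\<lambda>f. (X f) ^ 3) / (16 * M ^ 3) \<le> 0"
        using Mpos by (intro divide_nonpos_pos) auto
      then show ?thesis
        using Mpos by (intro mult_left_mono) auto
    qed
    finally show ?thesis
      by (simp add: mom)
  qed
  finally show ?thesis .
qed

subsection \<open>Volume of an opinion in one round\<close>

definition opinion_set :: "nat \<Rightarrow> (nat \<Rightarrow> nat) \<Rightarrow> nat \<Rightarrow> nat set" where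
  "opinion_set n c a = {u \<in> verts n. c u = a}"

text \<open>Summing over all nodes with an indicator gives a sum of functions of single coordinates,
  the shape that the estimate for product measures expects.\<close>

definition opinion_vol :: "nat \<Rightarrow> (nat \<Rightarrow> nat) \<Rightarrow> (nat \<Rightarrow> nat) \<Rightarrow> nat \<Rightarrow> real" where
  "opinion_vol n d c a = (\<Sum>u\<in>verts n. if c u = a then real (d u) else 0)"

lemma finite_verts [simp]: "finite (verts n)"
  by (simp add: verts_def)

lemma finite_nbrs [simp]: "finite (nbrs n E u)"
  by (simp add: nbrs_def)

lemma finite_opinion_set [simp]: "finite (opinion_set n c a)"
  by (simp add: opinion_set_def)

lemma opinion_set_subset: "opinion_set n c a \<subseteq> verts n"
  by (auto simp: opinion_set_def)

lemma opinion_vol_eq_sum: "opinion_vol n d c a = (\<Sum>u\<in>opinion_set n c a. real (d u))"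
  unfolding opinion_vol_def opinion_set_def by (simp add: sum.If_cases Int_def)

lemma opinion_vol_nonneg: "opinion_vol n d c a \<ge> 0"
  by (simp add: opinion_vol_eq_sum sum_nonneg)

lemma set_node_update_subset:
  assumes "u \<in> verts n"
  shows "set_pmf (node_update n E c u) \<subseteq> c ` verts n"
proof -
  have "c ` set_pmf (pmf_of_set (nbrs n E u)) \<subseteq> c ` verts n" if "nbrs n E u \<noteq> {}"
    using that by (auto simp: set_pmf_of_set) (auto simp: nbrs_def)
  then show ?thesis
    using assms by (fastforce simp: node_update_def split: if_splits)
qed

lemma finite_set_node_update [simp]:
  "u \<in> verts n \<Longrightarrow> finite (set_pmf (node_update n E c u))"
  by (rule finite_subset[OF set_node_update_subset]) auto

lemma finite_set_voter_step [simp]: "finite (set_pmf (voter_step n E c))"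
  unfolding voter_step_def by (intro finite_set_Pi_pmf) auto

lemma pmf_node_update:
  assumes "nbrs n E u \<noteq> {}"
  shows "pmf (node_update n E c u) a =
    (if c u = a then 1/2 else 0) + real (card {v \<in> nbrs n E u. c v = a}) / (2 * real (deg n E u))"
proof -
  have "nbrs n E u \<inter> c -` {a} = {v \<in> nbrs n E u. c v = a}"
    by auto
  then show ?thesis
    using assms
    by (auto simp: node_update_def pmf_bind pmf_map measure_pmf_of_set deg_def pmf_return)
qed

text \<open>The contribution of a node to the volume of one opinion takes two values, so its mean
  and central moments all come from this formula.\<close>

lemma expectation_pmf_If_eq:
  fixes \<alpha> \<beta> :: real
  shows "measure_pmf.expectation p (\<lambda>y. if y = a then \<alpha> else \<beta>) = pmf p a * \<alpha> + (1 - pmf p a) * \<beta>"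
proof -
  have "(\<lambda>y. if y = a then \<alpha> else \<beta>) = (\<lambda>y. \<beta> + (\<alpha> - \<beta>) * indicator {a} y)"
    by (auto simp: fun_eq_iff)
  then have "measure_pmf.expectation p (\<lambda>y. if y = a then \<alpha> else \<beta>) = \<beta> + (\<alpha> - \<beta>) * measure_pmf.prob p {a}"
    by (simp add: measure_pmf.emeasure_eq_measure)
  then show ?thesis
    by (simp add: measure_pmf_single algebra_simps)
qed

text \<open>Double counting of the adjacent pairs with second node in \<open>S\<close>; this is what
  makes the volume of an opinion a martingale.\<close>

lemma sum_card_nbrs_in:
  assumes "is_graph n E" "S \<subseteq> verts n"
  shows "(\<Sum>u\<in>verts n. card {v \<in> S. E u v}) = (\<Sum>v\<in>S. deg n E v)"
proof -
  have fS: "finite S" using finite_subset[OF assms(2)] by simp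
  have "(\<Sum>u\<in>verts n. card {v \<in> S. E u v}) = (\<Sum>u\<in>verts n. \<Sum>v\<in>S. if E u v then 1 else 0)"
    using fS by (simp add: sum.If_cases Int_def)
  also have "\<dots> = (\<Sum>v\<in>S. \<Sum>u\<in>verts n. if E v u then 1 else 0)"
    using assms(1) by (subst sum.swap) (auto simp: is_graph_def intro!: sum.cong)
  also have "\<dots> = (\<Sum>v\<in>S. deg n E v)"
    by (simp add: deg_def nbrs_def sum.If_cases Int_def)
  finally show ?thesis .
qed

lemma card_nbrs_in_plus_out_nbrs:
  assumes "S \<subseteq> verts n"
  shows "card {v \<in> S. E u v} + out_nbrs n E S u = deg n E u"
proof -
  have "nbrs n E u = {v \<in> S. E u v} \<union> {v \<in> verts n - S. E u v}"
    using assms by (auto simp: nbrs_def)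
  moreover have "finite {v \<in> S. E u v}"
    using finite_subset[OF assms] by auto
  ultimately show ?thesis
    unfolding deg_def out_nbrs_def by (subst card_Un_disjoint[symmetric]) auto
qed

text \<open>Node \<open>u\<close> contributes \<open>d u\<close> times a Bernoulli variable with
  mean \<open>P u\<close>. For supporters of \<open>a\<close>, \<open>P u \<ge> 1/2\<close> makes
  the third central moment nonpositive, and the variance is at least a quarter of \<open>d u\<close>
  times the number of neighbours outside \<open>S\<close>. The constant is 32 = 8 * 4.\<close>

lemma expectation_sqrt_opinion_vol_le:
  fixes c d :: "nat \<Rightarrow> nat" and a :: nat
  assumes G: "is_graph n E" and deg: "\<And>u. u \<in> verts n \<Longrightarrow> deg n E u = d u"
    and pos: "\<And>u. u \<in> verts n \<Longrightarrow> d u > 0"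
  defines "S \<equiv> opinion_set n c a" and "V \<equiv> opinion_vol n d c a"
  shows "measure_pmf.expectation (voter_step n E c) (\<lambda>c'. sqrt (opinion_vol n d c' a)) \<le>
    sqrt V * (1 - (\<Sum>u\<in>S. real (d u) * real (out_nbrs n E S u)) / (32 * V\<^sup>2))"
proof -
  define g where "g = (\<lambda>u x. if x = a then real (d u) else 0)"
  define P where "P = (\<lambda>u. pmf (node_update n E c u) a)"
  have SV: "S \<subseteq> verts n" by (simp add: S_def opinion_set_subset)
  have nb: "nbrs n E u \<noteq> {}" if "u \<in> verts n" for u
    using deg[OF that] pos[OF that] by (auto simp: deg_def)
  have P: "P u = (if u \<in> S then 1/2 else 0) + real (card {v \<in> S. E u v}) / (2 * real (d u))"
    if "u \<in> verts n" for u
  proof -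
    have "{v \<in> nbrs n E u. c v = a} = {v \<in> S. E u v}"
      by (auto simp: nbrs_def S_def opinion_set_def)
    then show ?thesis
      using that by (simp add: P_def pmf_node_update[OF nb] deg S_def opinion_set_def)
  qed
  have PS: "P u = 1 - real (out_nbrs n E S u) / (2 * real (d u))" "real (out_nbrs n E S u) \<le> real (d u)"
    if "u \<in> S" for u
  proof -
    have u: "u \<in> verts n" using that SV by auto
    have *: "card {v \<in> S. E u v} + out_nbrs n E S u = d u"
      using card_nbrs_in_plus_out_nbrs[OF SV, of E u] deg[OF u] by simp
    then show "real (out_nbrs n E S u) \<le> real (d u)" by linarith
    have "real (card {v \<in> S. E u v}) = real (d u) - real (out_nbrs n E S u)"
      using * by linarith
    then show "P u = 1 - real (out_nbrs n E S u) / (2 * real (d u))"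
      using P[OF u] that pos[OF u] by (simp add: field_simps)
  qed
  have P01: "P u \<ge> 0" "P u \<le> 1" for u
    by (auto simp: P_def pmf_le_1)
  have mu: "measure_pmf.expectation (node_update n E c u) (g u) = P u * real (d u)" for u
    unfolding g_def by (simp add: expectation_pmf_If_eq P_def)
  \<comment> \<open>One half of \<open>V\<close> comes from the nodes keeping their opinion, the
    other half from double counting.\<close>
  have mart: "V = (\<Sum>u\<in>verts n. P u * real (d u))"
  proof -
    have "(\<Sum>u\<in>verts n. P u * real (d u)) =
      (\<Sum>u\<in>verts n. (if u \<in> S then real (d u) else 0) / 2 + real (card {v \<in> S. E u v}) / 2)"
      using pos by (intro sum.cong) (auto simp: P field_simps)
    also have "\<dots> = (\<Sum>u\<in>verts n. if u \<in> S then real (d u) else 0) / 2 +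
       real (\<Sum>u\<in>verts n. card {v \<in> S. E u v}) / 2"
      by (simp add: sum.distrib sum_divide_distrib)
    also have "(\<Sum>u\<in>verts n. if u \<in> S then real (d u) else 0) = V"
      unfolding V_def opinion_vol_def by (intro sum.cong) (auto simp: S_def opinion_set_def)
    also have "real (\<Sum>u\<in>verts n. card {v \<in> S. E u v}) = V"
      unfolding sum_card_nbrs_in[OF G SV] V_def opinion_vol_eq_sum S_def[symmetric]
      using deg SV by (auto intro!: sum.cong)
    finally show ?thesis by simp
  qed
  have var: "measure_pmf.expectation (node_update n E c u) (\<lambda>y. (g u y - P u * real (d u))\<^sup>2) =
     (real (d u))\<^sup>2 * P u * (1 - P u)" for u
  proof -
    have "(\<lambda>y. (g u y - P u * real (d u))\<^sup>2) =
      (\<lambda>y. if y = a then (real (d u) - P u * real (d u))\<^sup>2 else (P u * real (d u))\<^sup>2)"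
      by (auto simp: g_def)
    then have "measure_pmf.expectation (node_update n E c u) (\<lambda>y. (g u y - P u * real (d u))\<^sup>2) =
      P u * (real (d u) - P u * real (d u))\<^sup>2 + (1 - P u) * (P u * real (d u))\<^sup>2"
      by (simp only: expectation_pmf_If_eq P_def)
    also have "\<dots> = (real (d u))\<^sup>2 * P u * (1 - P u)"
      by (simp add: power2_eq_square algebra_simps)
    finally show ?thesis .
  qed
  have third: "measure_pmf.expectation (node_update n E c u) (\<lambda>y. (g u y - P u * real (d u)) ^ 3) =
     (real (d u)) ^ 3 * P u * (1 - P u) * (1 - 2 * P u)" for u
  proof -
    have "(\<lambda>y. (g u y - P u * real (d u)) ^ 3) =
      (\<lambda>y. if y = a then (real (d u) - P u * real (d u)) ^ 3 else (- (P u * real (d u))) ^ 3)"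
      by (auto simp: g_def)
    then have "measure_pmf.expectation (node_update n E c u) (\<lambda>y. (g u y - P u * real (d u)) ^ 3) =
      P u * (real (d u) - P u * real (d u)) ^ 3 + (1 - P u) * (- (P u * real (d u))) ^ 3"
      by (simp only: expectation_pmf_If_eq P_def)
    also have "\<dots> = (real (d u)) ^ 3 * P u * (1 - P u) * (1 - 2 * P u)"
      by (simp add: power3_eq_cube algebra_simps)
    finally show ?thesis .
  qed
  \<comment> \<open>A supporter keeps its opinion with probability 1/2 already by not consulting a
    neighbour.\<close>
  have half: "P u \<ge> 1/2" if "u \<in> S" for u
  proof -
    have "real (out_nbrs n E S u) / (2 * real (d u)) \<le> 1/2"
      using PS(2)[OF that] pos[of u] that SV by (subst pos_divide_le_eq) auto
    then show ?thesis
      using PS(1)[OF that] by linarith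
  qed
  have "measure_pmf.expectation (voter_step n E c) (\<lambda>c'. sqrt (opinion_vol n d c' a)) =
    measure_pmf.expectation (Pi_pmf (verts n) 0 (node_update n E c)) (\<lambda>f. sqrt (\<Sum>u\<in>verts n. g u (f u)))"
    by (simp add: voter_step_def opinion_vol_def g_def)
  also have "\<dots> \<le> sqrt V * (1 - (\<Sum>u\<in>S. measure_pmf.expectation (node_update n E c u)
     (\<lambda>y. (g u y - measure_pmf.expectation (node_update n E c u) (g u))\<^sup>2)) / (8 * V\<^sup>2))"
  proof (rule expectation_sqrt_sum_Pi_pmf_le)
    fix u assume "u \<in> S"
    have "(real (d u)) ^ 3 * P u * (1 - P u) * (1 - 2 * P u) \<le> 0"
      using half[OF \<open>u \<in> S\<close>] P01[of u] by (intro mult_nonneg_nonpos mult_nonneg_nonneg) auto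
    then show "measure_pmf.expectation (node_update n E c u)
       (\<lambda>y. (g u y - measure_pmf.expectation (node_update n E c u) (g u)) ^ 3) \<le> 0"
      unfolding mu third .
  qed (use SV mart in \<open>auto simp: g_def[symmetric] mu\<close>, auto simp: g_def)
  also have "\<dots> \<le> sqrt V * (1 - (\<Sum>u\<in>S. real (d u) * real (out_nbrs n E S u) / 4) / (8 * V\<^sup>2))"
  proof -
    have "(\<Sum>u\<in>S. real (d u) * real (out_nbrs n E S u) / 4) \<le> (\<Sum>u\<in>S. (real (d u))\<^sup>2 * P u * (1 - P u))"
    proof (rule sum_mono)
      fix u assume u: "u \<in> S"
      \<comment> \<open>The factor \<open>1 - P u\<close> is the outside degree over
        \<open>2 * d u\<close>; the other factor \<open>P u\<close> is then bounded below by
        1/2.\<close>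
      have "real (d u) * real (out_nbrs n E S u) / 4 = (real (d u))\<^sup>2 * (1/2) * (1 - P u)"
        using pos[of u] u SV by (auto simp: PS(1)[OF u] power2_eq_square field_simps)
      also have "\<dots> \<le> (real (d u))\<^sup>2 * P u * (1 - P u)"
        using half[OF u] P01[of u] by (intro mult_right_mono mult_left_mono) auto
      finally show "real (d u) * real (out_nbrs n E S u) / 4 \<le> (real (d u))\<^sup>2 * P u * (1 - P u)" .
    qed
    then show ?thesis
      unfolding mu var
      by (intro mult_left_mono diff_left_mono divide_right_mono) (auto simp: V_def opinion_vol_nonneg)
  qed
  also have "\<dots> = sqrt V * (1 - (\<Sum>u\<in>S. real (d u) * real (out_nbrs n E S u)) / (32 * V\<^sup>2))"
    by (simp add: sum_divide_distrib[symmetric])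
  finally show ?thesis .
qed

subsection \<open>Edge counts, conductance and the potential\<close>

text \<open>Handshake lemma: since loops are excluded, the map from ordered adjacent pairs to edges
  has fibres of size two.\<close>

lemma sum_deg_eq_twice_num_edges:
  assumes G: "is_graph n E"
  shows "(\<Sum>u\<in>verts n. deg n E u) = 2 * num_edges n E"
proof -
  define A where "A = Sigma (verts n) (nbrs n E)"
  define f where "f = (\<lambda>(u, v). {u, v} :: nat set)"
  have finA: "finite A" by (simp add: A_def)
  have fA: "f ` A = {{u, v} | u v. u \<in> verts n \<and> v \<in> verts n \<and> E u v}"
    by (force simp: A_def f_def nbrs_def)
  have fiber: "(\<Sum>p\<in>{p \<in> A. f p = e}. 1) = (2 :: nat)" if "e \<in> f ` A" for e
  proof -
    from that obtain u v where uv: "e = {u, v}" "u \<in> verts n" "v \<in> verts n" "E u v"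
      unfolding fA by auto
    have "E v u" "u \<noteq> v" using G uv(4) by (auto simp: is_graph_def)
    then have "{p \<in> A. f p = e} = {(u, v), (v, u)}"
      using uv by (auto simp: A_def f_def nbrs_def doubleton_eq_iff)
    with \<open>u \<noteq> v\<close> show ?thesis by simp
  qed
  have "(\<Sum>u\<in>verts n. deg n E u) = card A"
    by (simp add: A_def deg_def)
  also have "\<dots> = (\<Sum>e\<in>f ` A. \<Sum>p\<in>{p \<in> A. f p = e}. 1)"
    using sum.image_gen[OF finA, of "\<lambda>_. 1 :: nat" f] by simp
  also have "\<dots> = 2 * card (f ` A)"
    using sum.cong[OF refl fiber, of "f ` A"] by simp
  finally show ?thesis
    unfolding fA num_edges_def .
qed

lemma conductance_mult_vol_le:
  assumes "\<phi> \<le> conductance n E" "U \<subset> verts n" "0 < vol n E U" "vol n E U \<le> num_edges n E"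
  shows "\<phi> * real (vol n E U) \<le> real (\<Sum>u\<in>U. out_nbrs n E U u)"
proof -
  let ?R = "{real (\<Sum>u\<in>U. out_nbrs n E U u) / real (vol n E U) | U.
      U \<subset> verts n \<and> 0 < vol n E U \<and> vol n E U \<le> num_edges n E}"
  have "?R \<subseteq> (\<lambda>U. real (\<Sum>u\<in>U. out_nbrs n E U u) / real (vol n E U)) ` Pow (verts n)"
    by auto
  \<comment> \<open>\<open>Min\<close> is a lower bound only over a finite set.\<close>
  then have "finite ?R"
    by (rule finite_subset) auto
  then have "conductance n E \<le> real (\<Sum>u\<in>U. out_nbrs n E U u) / real (vol n E U)"
    unfolding conductance_def using assms by (intro Min_le) auto
  with assms(1) have "\<phi> \<le> real (\<Sum>u\<in>U. out_nbrs n E U u) / real (vol n E U)"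
    by linarith
  then show ?thesis
    using assms(3) by (simp add: pos_le_divide_eq)
qed

text \<open>A path from \<open>u\<close> to some other node starts with an edge at \<open>u\<close>;
  \<open>n \<ge> 2\<close> supplies that other node.\<close>

lemma connected_graph_deg_pos:
  assumes "connected_graph n E" "is_graph n E" "n \<ge> 2" "u \<in> verts n"
  shows "deg n E u > 0"
proof -
  have "\<exists>v\<in>verts n. v \<noteq> u"
    using assms(3) by (intro bexI[of _ "if u = 1 then 2 else 1"]) (auto simp: verts_def)
  then obtain v where v: "v \<in> verts n" "v \<noteq> u" by blast
  then have "E\<^sup>*\<^sup>* u v"
    using assms by (auto simp: connected_graph_def)
  then obtain w where "E u w"
    using v(2) by (metis converse_rtranclpE)
  then have "w \<in> nbrs n E u"
    using assms(2) by (auto simp: nbrs_def is_graph_def)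
  then show ?thesis
    by (auto simp: deg_def card_gt_0_iff)
qed

section \<open>Sums of square roots of probability weights\<close>

context
  fixes K :: "'a set" and p :: "'a \<Rightarrow> real"
  assumes fin: "finite K" and nonneg: "\<And>a. a \<in> K \<Longrightarrow> p a \<ge> 0" and sum1: "(\<Sum>a\<in>K. p a) = 1"
begin

lemma weight_le_one: "a \<in> K \<Longrightarrow> p a \<le> 1"
  using member_le_sum[of a K p] fin nonneg sum1 by auto

lemma weight_le_sqrt: "a \<in> K \<Longrightarrow> p a \<le> sqrt (p a)"
  using weight_le_one[of a] nonneg[of a]
  by (intro real_le_rsqrt) (auto simp: power2_eq_square mult_left_le)

lemma sum_sqrt_ge_one: "1 \<le> (\<Sum>a\<in>K. sqrt (p a))"
  using sum_mono[of K p "\<lambda>a. sqrt (p a)"] weight_le_sqrt sum1 by simp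

lemma heavy_weight_unique:
  assumes "a \<in> K" "b \<in> K" "p a > 1/2" "p b > 1/2"
  shows "a = b"
proof (rule ccontr)
  assume "a \<noteq> b"
  then have "p a + p b = sum p {a, b}" by simp
  also have "\<dots> \<le> sum p K"
    using assms fin nonneg by (intro sum_mono2) auto
  finally show False using sum1 assms by simp
qed

context
  fixes L :: "'a set"
  assumes L: "L = {a \<in> K. 0 < p a \<and> p a \<le> 1/2}"
begin

text \<open>By Cauchy-Schwarz the square is at most the number of positive weights. At most one of
  them exceeds 1/2, and a nonempty \<open>L\<close> absorbs it into the factor 2.\<close>

lemma sum_sqrt_squared_le:
  assumes "L \<noteq> {}"
  shows "(\<Sum>a\<in>K. sqrt (p a))\<^sup>2 \<le> 2 * real (card L)"
proof -
  define H where "H = {a \<in> K. p a > 1/2}"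
  have finL: "finite L" and finH: "finite H" using fin by (auto simp: L H_def)
  have "card H \<le> 1"
    unfolding One_nat_def card_le_Suc0_iff_eq[OF finH] using heavy_weight_unique by (auto simp: H_def)
  moreover have "card L \<ge> 1"
    using assms finL by (simp add: Suc_leI card_gt_0_iff)
  ultimately have cards: "card (L \<union> H) \<le> 2 * card L"
    using card_Un_le[of L H] by linarith
  have zero: "sqrt (p a) = 0" if "a \<in> K - (L \<union> H)" for a
    using that nonneg[of a] by (auto simp: L H_def)
  have "(\<Sum>a\<in>K. sqrt (p a)) = (\<Sum>a\<in>L \<union> H. 1 * sqrt (p a))"
    unfolding mult_1 by (rule sum.mono_neutral_right) (use fin zero in \<open>auto simp: L H_def\<close>)
  then have "(\<Sum>a\<in>K. sqrt (p a))\<^sup>2 \<le> (\<Sum>a\<in>L \<union> H. 1\<^sup>2) * (\<Sum>a\<in>L \<union> H. (sqrt (p a))\<^sup>2)"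
    using Cauchy_Schwarz_ineq_sum[of "\<lambda>_. 1" "\<lambda>a. sqrt (p a)" "L \<union> H"] by simp
  also have "(\<Sum>a\<in>L \<union> H. (sqrt (p a))\<^sup>2) = (\<Sum>a\<in>L \<union> H. p a)"
    using nonneg by (intro sum.cong) (auto simp: L H_def)
  also have "(\<Sum>a\<in>L \<union> H. 1\<^sup>2) * \<dots> \<le> (\<Sum>a\<in>L \<union> H. 1\<^sup>2) * (\<Sum>a\<in>K. p a)"
    using fin nonneg by (intro mult_left_mono sum_mono2) (auto simp: L H_def)
  finally have "(\<Sum>a\<in>K. sqrt (p a))\<^sup>2 \<le> real (card (L \<union> H))"
    by (simp add: sum1)
  with cards show ?thesis by linarith
qed

text \<open>The positive weights outside \<open>L\<close> number at most one, and the root of that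
  one is at most 1.\<close>

lemma sum_sqrt_minus_one_le: "(\<Sum>a\<in>K. sqrt (p a)) - 1 \<le> (\<Sum>a\<in>L. sqrt (p a))"
proof (cases "\<exists>b\<in>K. p b > 1/2")
  case False
  then have "(\<Sum>a\<in>K. sqrt (p a)) = (\<Sum>a\<in>L. sqrt (p a))"
    using fin nonneg by (intro sum.mono_neutral_right) (force simp: L)+
  then show ?thesis by simp
next
  case True
  then obtain b where b: "b \<in> K" "p b > 1/2" by blast
  have "(\<Sum>a\<in>K. sqrt (p a)) = sqrt (p b) + (\<Sum>a\<in>K - {b}. sqrt (p a))"
    using fin b by (simp add: sum.remove)
  also have "(\<Sum>a\<in>K - {b}. sqrt (p a)) = (\<Sum>a\<in>L. sqrt (p a))"
  proof (rule sum.mono_neutral_right)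
    show "\<forall>a\<in>K - {b} - L. sqrt (p a) = 0"
    proof
      fix a assume a: "a \<in> K - {b} - L"
      then have "\<not> p a > 1/2" using heavy_weight_unique[of a b] b by auto
      with a nonneg[of a] show "sqrt (p a) = 0" by (auto simp: L)
    qed
  qed (use fin b in \<open>auto simp: L\<close>)
  also have "sqrt (p b) \<le> 1"
    using weight_le_one[OF b(1)] by simp
  finally show ?thesis by simp
qed

text \<open>The right-hand side is the sum of the nonnegative terms \<open>sqrt (p a) - p a\<close>,
  so a single light weight suffices; its root is at most 3/4, which leaves the factor 1/4.\<close>

lemma sum_sqrt_minus_one_ge:
  assumes "a \<in> L" "0 < e" "e\<^sup>2 \<le> p a"
  shows "e / 4 \<le> (\<Sum>a\<in>K. sqrt (p a)) - 1"
proof -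
  have a: "a \<in> K" "0 < p a" "p a \<le> 1/2" using assms by (auto simp: L)
  have s: "e \<le> sqrt (p a)" "sqrt (p a) \<le> 3/4"
  proof -
    show "e \<le> sqrt (p a)" using assms(3) by (rule real_le_rsqrt)
    show "sqrt (p a) \<le> 3/4" using a by (intro real_le_lsqrt) (auto simp: power2_eq_square)
  qed
  have "e * (1/4) \<le> sqrt (p a) * (1 - sqrt (p a))"
    using s assms(2) a by (intro mult_mono) auto
  also have "\<dots> = sqrt (p a) - p a"
    using a by (simp add: algebra_simps)
  also have "\<dots> \<le> (\<Sum>a\<in>K. sqrt (p a) - p a)"
    using a fin weight_le_sqrt by (intro member_le_sum[where f = "\<lambda>a. sqrt (p a) - p a"]) auto
  finally show ?thesis
    by (simp add: sum_subtractf sum1)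
qed

end

end

section \<open>Potential of a configuration\<close>

definition opinion_frac :: "nat \<Rightarrow> (nat \<Rightarrow> nat) \<Rightarrow> (nat \<Rightarrow> nat) \<Rightarrow> nat \<Rightarrow> real" where
  "opinion_frac n d c a = opinion_vol n d c a / real (\<Sum>u\<in>verts n. d u)"

definition potential :: "nat \<Rightarrow> (nat \<Rightarrow> nat) \<Rightarrow> nat \<Rightarrow> (nat \<Rightarrow> nat) \<Rightarrow> real" where
  "potential n d \<kappa> c = (\<Sum>a=1..\<kappa>. sqrt (opinion_frac n d c a))"

definition light_opinions :: "nat \<Rightarrow> (nat \<Rightarrow> nat) \<Rightarrow> nat \<Rightarrow> (nat \<Rightarrow> nat) \<Rightarrow> nat set" where
  "light_opinions n d \<kappa> c = {a \<in> {1..\<kappa>}. 0 < opinion_frac n d c a \<and> opinion_frac n d c a \<le> 1/2}"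

lemma opinion_frac_nonneg: "opinion_frac n d c a \<ge> 0"
  by (simp add: opinion_frac_def opinion_vol_nonneg sum_nonneg)

lemma sum_opinion_frac:
  assumes "(\<Sum>u\<in>verts n. d u) > 0" "c ` verts n \<subseteq> {1..\<kappa>}"
  shows "(\<Sum>a=1..\<kappa>. opinion_frac n d c a) = 1"
proof -
  have "(\<Sum>a=1..\<kappa>. opinion_vol n d c a) = (\<Sum>u\<in>verts n. \<Sum>a=1..\<kappa>. if c u = a then real (d u) else 0)"
    unfolding opinion_vol_def by (rule sum.swap)
  also have "\<dots> = (\<Sum>u\<in>verts n. real (d u))"
  proof (intro sum.cong refl)
    fix u assume "u \<in> verts n"
    with assms(2) have "c u \<in> {1..\<kappa>}" by blast
    then show "(\<Sum>a=1..\<kappa>. if c u = a then real (d u) else 0) = real (d u)"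
      by (simp add: sum.delta)
  qed
  finally have "(\<Sum>a=1..\<kappa>. opinion_vol n d c a) = real (\<Sum>u\<in>verts n. d u)"
    by simp
  moreover have "real (\<Sum>u\<in>verts n. d u) \<noteq> 0"
    using assms(1) by linarith
  ultimately show ?thesis
    unfolding opinion_frac_def sum_divide_distrib[symmetric] by (simp only: divide_self_if if_False)
qed

subsection \<open>Expected change of the potential\<close>

text \<open>Given the history, the graph of the next round is determined, so one round is analysed
  for a fixed graph and a fixed configuration.\<close>

locale voter_round =
  fixes n :: nat and E :: "nat \<Rightarrow> nat \<Rightarrow> bool" and d :: "nat \<Rightarrow> nat" and \<phi> :: real
    and \<kappa> :: nat and c :: "nat \<Rightarrow> nat"
  assumes graph: "is_graph n E" and connected: "connected_graph n E"
    and deg_eq: "\<And>u. u \<in> verts n \<Longrightarrow> deg n E u = d u"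
    and two_le: "n \<ge> 2" and cond: "\<phi> \<le> conductance n E" and phi_nonneg: "\<phi> \<ge> 0"
    and range: "c ` verts n \<subseteq> {1..\<kappa>}"
begin

abbreviation "W \<equiv> \<Sum>u\<in>verts n. d u"
abbreviation "V \<equiv> opinion_vol n d c"
abbreviation "p \<equiv> opinion_frac n d c"
abbreviation "L \<equiv> light_opinions n d \<kappa> c"
abbreviation "S \<equiv> opinion_set n c"
abbreviation "D a \<equiv> \<Sum>u\<in>S a. real (d u) * real (out_nbrs n E (S a) u)"

lemma d_pos: "u \<in> verts n \<Longrightarrow> d u > 0"
  using connected_graph_deg_pos[OF connected graph two_le] deg_eq by metis

lemma verts_nonempty: "verts n \<noteq> {}"
  using two_le by (auto simp: verts_def)

lemma W_pos: "W > 0"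
  using d_pos verts_nonempty by (intro sum_pos) auto

lemma W_le: "W \<le> n\<^sup>2"
proof -
  have "nbrs n E u \<subseteq> verts n" for u
    by (auto simp: nbrs_def)
  then have "deg n E u \<le> n" for u
    using card_mono[OF finite_verts, of "nbrs n E u" n] by (simp add: deg_def verts_def)
  then have "W \<le> (\<Sum>u\<in>verts n. n)"
    using deg_eq by (intro sum_mono) metis
  then show ?thesis
    by (simp add: verts_def power2_eq_square)
qed

lemma W_eq: "W = 2 * num_edges n E"
  using sum_deg_eq_twice_num_edges[OF graph] deg_eq by simp

lemma sum_p: "(\<Sum>a=1..\<kappa>. p a) = 1"
  by (rule sum_opinion_frac[OF W_pos range])

text \<open>These discharge the premises of the context on probability weights, in its order, with
  \<open>opinion_frac\<close> as the weights.\<close>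

lemmas weight_facts = finite_atLeastAtMost[of 1 \<kappa>] opinion_frac_nonneg sum_p

lemmas light_weight_facts = weight_facts light_opinions_def

lemma potential_ge_one: "1 \<le> potential n d \<kappa> c"
  unfolding potential_def by (rule sum_sqrt_ge_one[OF weight_facts])

lemma potential_le: "potential n d \<kappa> c \<le> real \<kappa>"
proof -
  have "sqrt (p a) \<le> 1" if "a \<in> {1..\<kappa>}" for a
    using weight_le_one[OF weight_facts that] by simp
  then have "potential n d \<kappa> c \<le> (\<Sum>a=1..\<kappa>. 1)"
    unfolding potential_def by (intro sum_mono) blast
  then show ?thesis by simp
qed

lemma V_eq_vol: "V a = real (vol n E (S a))"
  using deg_eq by (auto simp: opinion_vol_eq_sum vol_def opinion_set_def)

lemma V_pos: "a \<in> L \<Longrightarrow> V a > 0"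
  using W_pos opinion_vol_nonneg[of n d c a]
  by (cases "V a = 0") (auto simp: light_opinions_def opinion_frac_def)

lemma out_nbrs_ge:
  assumes "a \<in> L"
  shows "\<phi> * V a \<le> (\<Sum>u\<in>S a. real (out_nbrs n E (S a) u))"
proof -
  have "p a \<le> 1/2" using assms by (auto simp: light_opinions_def)
  then have le: "V a \<le> real W / 2"
    using W_pos by (simp add: opinion_frac_def field_simps del: of_nat_sum)
  \<comment> \<open>Conductance ranges over proper subsets; the full set would have volume
    \<open>W\<close> rather than at most half of it.\<close>
  have "S a \<noteq> verts n"
  proof
    assume "S a = verts n"
    then have "V a = real W" by (simp add: opinion_vol_eq_sum)
    with le W_pos show False by linarith
  qed
  then have "S a \<subset> verts n" using opinion_set_subset by blast
  moreover have "vol n E (S a) \<le> num_edges n E"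
    using le unfolding V_eq_vol W_eq by simp
  moreover have "0 < vol n E (S a)"
    using V_pos[OF assms] unfolding V_eq_vol by simp
  ultimately show ?thesis
    using conductance_mult_vol_le[OF cond] unfolding V_eq_vol by simp
qed

section \<open>Lower bounds for the loss and the resulting drift\<close>

lemma D_nonneg: "D a \<ge> 0"
  by (intro sum_nonneg) auto

lemma D_ge_linear:
  assumes "a \<in> L"
  shows "real (Min (d ` verts n)) * (\<phi> * V a) \<le> D a"
proof -
  have "real (Min (d ` verts n)) * (\<phi> * V a) \<le>
      real (Min (d ` verts n)) * (\<Sum>u\<in>S a. real (out_nbrs n E (S a) u))"
    by (intro mult_left_mono out_nbrs_ge assms) auto
  also have "\<dots> \<le> D a"
    unfolding sum_distrib_left
    by (intro sum_mono mult_right_mono) (auto simp: opinion_set_def)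
  finally show ?thesis .
qed

lemma D_ge_quadratic:
  assumes "a \<in> L"
  shows "(\<phi> * V a)\<^sup>2 / real n \<le> D a"
proof -
  let ?o = "\<lambda>u. real (out_nbrs n E (S a) u)"
  have o_le: "?o u \<le> real (d u)" if "u \<in> S a" for u
    using card_nbrs_in_plus_out_nbrs[OF opinion_set_subset[of n c a], of E u] deg_eq[of u] that
    by (auto simp: opinion_set_def)
  have "card (S a) \<le> n"
    using card_mono[OF _ opinion_set_subset[of n c a]] by (simp add: verts_def)
  have "(\<phi> * V a)\<^sup>2 \<le> (\<Sum>u\<in>S a. ?o u)\<^sup>2"
    using phi_nonneg V_pos[OF assms] out_nbrs_ge[OF assms] by (intro power_mono) auto
  also have "\<dots> \<le> real (card (S a)) * (\<Sum>u\<in>S a. (?o u)\<^sup>2)"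
    using Cauchy_Schwarz_ineq_sum[of "\<lambda>_. 1" ?o "S a"] by simp
  also have "\<dots> \<le> real n * D a"
  proof (rule mult_mono)
    show "(\<Sum>u\<in>S a. (?o u)\<^sup>2) \<le> D a"
      unfolding power2_eq_square using o_le by (intro sum_mono mult_right_mono) auto
  qed (use \<open>card (S a) \<le> n\<close> in \<open>auto intro: sum_nonneg\<close>)
  finally show ?thesis
    using two_le by (simp add: field_simps)
qed

text \<open>Common frame for both drift bounds: \<open>r\<close> is any lower bound for the losses
  of the light opinions, while the nonnegative losses of all other opinions are discarded.\<close>

lemma expectation_potential_le:
  assumes "\<And>a. a \<in> L \<Longrightarrow> r a \<le> sqrt (p a) * (D a / (32 * (V a)\<^sup>2))"
  shows "measure_pmf.expectation (voter_step n E c) (potential n d \<kappa>) \<le>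
    potential n d \<kappa> c - (\<Sum>a\<in>L. r a)"
proof -
  note [simp] = integrable_measure_pmf_finite[OF finite_set_voter_step]
  have one: "measure_pmf.expectation (voter_step n E c) (\<lambda>c'. sqrt (opinion_frac n d c' a)) \<le>
      sqrt (p a) - sqrt (p a) * (D a / (32 * (V a)\<^sup>2))" for a
  proof -
    have "measure_pmf.expectation (voter_step n E c) (\<lambda>c'. sqrt (opinion_vol n d c' a)) / sqrt W \<le>
        sqrt (V a) * (1 - D a / (32 * (V a)\<^sup>2)) / sqrt W"
      by (intro divide_right_mono expectation_sqrt_opinion_vol_le graph deg_eq d_pos) (auto intro: sum_nonneg)
    then show ?thesis
      by (simp add: opinion_frac_def real_sqrt_divide right_diff_distrib diff_divide_distrib mult_ac del: of_nat_sum)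
  qed
  have "measure_pmf.expectation (voter_step n E c) (potential n d \<kappa>) =
      (\<Sum>a=1..\<kappa>. measure_pmf.expectation (voter_step n E c) (\<lambda>c'. sqrt (opinion_frac n d c' a)))"
    unfolding potential_def by (simp add: Bochner_Integration.integral_sum)
  also have "\<dots> \<le> (\<Sum>a=1..\<kappa>. sqrt (p a) - (if a \<in> L then r a else 0))"
  proof (rule sum_mono)
    fix a
    have "(if a \<in> L then r a else 0) \<le> sqrt (p a) * (D a / (32 * (V a)\<^sup>2))"
      using assms[of a] D_nonneg[of a] opinion_frac_nonneg[of n d c a] by auto
    with one[of a] show "measure_pmf.expectation (voter_step n E c) (\<lambda>c'. sqrt (opinion_frac n d c' a)) \<le>
      sqrt (p a) - (if a \<in> L then r a else 0)" by linarith
  qed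
  also have "\<dots> = potential n d \<kappa> c - (\<Sum>a\<in>{1..\<kappa>} \<inter> L. r a)"
    by (simp add: sum_subtractf potential_def sum.inter_restrict)
  also have "{1..\<kappa>} \<inter> L = L"
    by (auto simp: light_opinions_def)
  finally show ?thesis .
qed

text \<open>Weakening \<open>sqrt (p a)\<close> to \<open>p a\<close> cancels the remaining
  \<open>V a\<close>, so every light opinion loses the same amount and the drift counts the light
  opinions.\<close>

lemma expectation_potential_le_linear:
  "measure_pmf.expectation (voter_step n E c) (potential n d \<kappa>) \<le>
    potential n d \<kappa> c - real (card L) * (real (Min (d ` verts n)) * \<phi> / (32 * real W))"
proof -
  have "measure_pmf.expectation (voter_step n E c) (potential n d \<kappa>) \<le>
    potential n d \<kappa> c - (\<Sum>a\<in>L. real (Min (d ` verts n)) * \<phi> / (32 * real W))"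
  proof (rule expectation_potential_le)
    fix a assume a: "a \<in> L"
    note Va = V_pos[OF a]
    have "real (Min (d ` verts n)) * \<phi> / (32 * real W) =
        p a * (real (Min (d ` verts n)) * (\<phi> * V a) / (32 * (V a)\<^sup>2))"
      using Va W_pos by (simp add: opinion_frac_def power2_eq_square field_simps del: of_nat_sum)
    also have "\<dots> \<le> sqrt (p a) * (D a / (32 * (V a)\<^sup>2))"
      using Va phi_nonneg weight_le_sqrt[OF weight_facts, of a] D_ge_linear[OF a] a
      by (intro mult_mono divide_right_mono) (auto simp: light_opinions_def)
    finally show "real (Min (d ` verts n)) * \<phi> / (32 * real W) \<le> sqrt (p a) * (D a / (32 * (V a)\<^sup>2))" .
  qed
  then show ?thesis by simp
qed

text \<open>The quadratic bound cancels \<open>(V a)\<^sup>2\<close> completely, so each loss is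
  proportional to \<open>sqrt (p a)\<close>; over the light opinions these roots add up to at least
  the potential minus 1.\<close>

lemma expectation_potential_le_quadratic:
  "measure_pmf.expectation (voter_step n E c) (potential n d \<kappa>) - 1 \<le>
    (1 - \<phi>\<^sup>2 / (32 * real n)) * (potential n d \<kappa> c - 1)"
proof -
  have "measure_pmf.expectation (voter_step n E c) (potential n d \<kappa>) \<le>
    potential n d \<kappa> c - (\<Sum>a\<in>L. \<phi>\<^sup>2 / (32 * real n) * sqrt (p a))"
  proof (rule expectation_potential_le)
    fix a assume a: "a \<in> L"
    note Va = V_pos[OF a]
    have "\<phi>\<^sup>2 / (32 * real n) * sqrt (p a) = sqrt (p a) * ((\<phi> * V a)\<^sup>2 / real n / (32 * (V a)\<^sup>2))"
      using Va by (simp add: power_mult_distrib field_simps)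
    also have "\<dots> \<le> sqrt (p a) * (D a / (32 * (V a)\<^sup>2))"
      by (intro mult_left_mono divide_right_mono D_ge_quadratic a) (auto simp: opinion_frac_nonneg)
    finally show "\<phi>\<^sup>2 / (32 * real n) * sqrt (p a) \<le> sqrt (p a) * (D a / (32 * (V a)\<^sup>2))" .
  qed
  also have "(\<Sum>a\<in>L. \<phi>\<^sup>2 / (32 * real n) * sqrt (p a)) = \<phi>\<^sup>2 / (32 * real n) * (\<Sum>a\<in>L. sqrt (p a))"
    by (simp add: sum_distrib_left)
  also have "potential n d \<kappa> c - \<phi>\<^sup>2 / (32 * real n) * (\<Sum>a\<in>L. sqrt (p a)) \<le>
      potential n d \<kappa> c - \<phi>\<^sup>2 / (32 * real n) * (potential n d \<kappa> c - 1)"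
    using sum_sqrt_minus_one_le[OF light_weight_facts] unfolding potential_def
    by (intro diff_left_mono mult_left_mono) auto
  finally show ?thesis
    by (simp add: algebra_simps)
qed

lemma set_voter_step_range:
  assumes "c' \<in> set_pmf (voter_step n E c)"
  shows "c' ` verts n \<subseteq> {1..\<kappa>}"
proof safe
  fix u assume u: "u \<in> verts n"
  have "c' u \<in> set_pmf (node_update n E c u)"
    using assms u by (auto simp: voter_step_def set_Pi_pmf PiE_dflt_def)
  then show "c' u \<in> {1..\<kappa>}"
    using set_node_update_subset[OF u, of E c] range by blast
qed

lemma V_ge_one: "u \<in> verts n \<Longrightarrow> V (c u) \<ge> 1"
proof -
  assume u: "u \<in> verts n"
  have "1 \<le> real (d u)" using d_pos[OF u] by simp
  also have "\<dots> \<le> V (c u)"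
    unfolding opinion_vol_eq_sum using u
    by (intro member_le_sum[where f = "\<lambda>u. real (d u)"]) (auto simp: opinion_set_def)
  finally show ?thesis .
qed

text \<open>Two different opinions that are both present cannot both hold more than half of the
  volume.\<close>

lemma exists_light_opinion:
  assumes "\<not> consensus n c"
  obtains a where "a \<in> L" "V a \<ge> 1"
proof -
  obtain u v where uv: "u \<in> verts n" "v \<in> verts n" "c u \<noteq> c v"
    using assms by (auto simp: consensus_def)
  have pos: "0 < p (c w)" if "w \<in> verts n" for w
    using V_ge_one[OF that] W_pos unfolding opinion_frac_def by (intro divide_pos_pos) linarith+
  have K: "c u \<in> {1..\<kappa>}" "c v \<in> {1..\<kappa>}"
    using range uv by blast+
  then have "p (c u) \<le> 1/2 \<or> p (c v) \<le> 1/2"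
    using heavy_weight_unique[OF weight_facts K] uv(3) by fastforce
  then have "c u \<in> L \<or> c v \<in> L"
    using K pos uv by (auto simp: light_opinions_def)
  then show thesis
    using that V_ge_one uv by blast
qed

text \<open>A light opinion has volume at least 1 out of \<open>W \<le> n\<^sup>2\<close>, so the
  root of its fraction is at least \<open>1 / n\<close>.\<close>

lemma potential_minus_one_ge:
  assumes "\<not> consensus n c"
  shows "1 / (4 * real n) \<le> potential n d \<kappa> c - 1"
proof -
  obtain a where a: "a \<in> L" "V a \<ge> 1"
    using exists_light_opinion[OF assms] .
  have "(1 / real n)\<^sup>2 = 1 / real (n\<^sup>2)"
    by (simp add: power_divide)
  also have "\<dots> \<le> V a / real W"
    using a W_le W_pos by (intro frac_le) (auto simp del: of_nat_sum simp: of_nat_le_iff)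
  finally have "(1 / real n)\<^sup>2 \<le> p a"
    by (simp only: opinion_frac_def)
  from sum_sqrt_minus_one_ge[OF light_weight_facts a(1) _ this] show ?thesis
    using two_le by (simp add: potential_def)
qed

text \<open>Keeping the graph and changing the configuration makes the bounds on the potential
  available for the outcome of the round.\<close>

lemma voter_round_step:
  assumes "c' \<in> set_pmf (voter_step n E c)"
  shows "voter_round n E d \<phi> \<kappa> c'"
  using graph connected deg_eq two_le cond phi_nonneg set_voter_step_range[OF assms]
  by unfold_locales

text \<open>The concave function \<open>- 1 / x\<close> lies below its tangent at \<open>y\<close>,
  which has slope \<open>1 / y\<^sup>2\<close>. The drift is proportional to \<open>card L\<close>,
  and \<open>y\<^sup>2 \<le> 2 * card L\<close> without consensus, so the quotient is bounded below
  independently of the configuration.\<close>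

lemma expectation_neg_inverse_potential_le:
  "measure_pmf.expectation (voter_step n E c) (\<lambda>c'. - 1 / potential n d \<kappa> c') \<le>
    - 1 / potential n d \<kappa> c -
      of_bool (\<not> consensus n c) * (real (Min (d ` verts n)) * \<phi> / (64 * real W))"
proof -
  note [simp] = integrable_measure_pmf_finite[OF finite_set_voter_step]
  define y where "y = potential n d \<kappa> c"
  define \<epsilon> where "\<epsilon> = real (Min (d ` verts n)) * \<phi> / (32 * real W)"
  have eps: "\<epsilon> \<ge> 0"
    unfolding \<epsilon>_def using phi_nonneg by (intro divide_nonneg_nonneg mult_nonneg_nonneg) linarith+
  have y: "y \<ge> 1" using potential_ge_one by (simp add: y_def)
  have "measure_pmf.expectation (voter_step n E c) (\<lambda>c'. - 1 / potential n d \<kappa> c') \<le>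
    measure_pmf.expectation (voter_step n E c) (\<lambda>c'. - 1 / y + (potential n d \<kappa> c' - y) / y\<^sup>2)"
  proof (rule expectation_mono_pmf_finite[OF finite_set_voter_step])
    fix c' assume "c' \<in> set_pmf (voter_step n E c)"
    then have "potential n d \<kappa> c' \<ge> 1" (is "?x \<ge> 1")
      by (rule voter_round.potential_ge_one[OF voter_round_step])
    then have "- 1 / y + (?x - y) / y\<^sup>2 - (- 1 / ?x) = (?x - y)\<^sup>2 / (?x * y\<^sup>2)"
      using y by (simp add: power2_eq_square field_simps)
    also have "\<dots> \<ge> 0"
      using \<open>?x \<ge> 1\<close> by auto
    finally show "- 1 / ?x \<le> - 1 / y + (?x - y) / y\<^sup>2" by simp
  qed
  also have "\<dots> = - 1 / y + (measure_pmf.expectation (voter_step n E c) (potential n d \<kappa>) - y) / y\<^sup>2"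
    by simp
  also have "\<dots> \<le> - 1 / y + (- (real (card L) * \<epsilon>)) / y\<^sup>2"
    using expectation_potential_le_linear
    by (intro add_left_mono divide_right_mono) (auto simp: y_def \<epsilon>_def)
  also have "\<dots> \<le> - 1 / y - of_bool (\<not> consensus n c) * (\<epsilon> / 2)"
  proof (cases "consensus n c")
    case True
    then show ?thesis using eps y by simp
  next
    case False
    then have "L \<noteq> {}" using exists_light_opinion by blast
    from sum_sqrt_squared_le[OF light_weight_facts this]
    have "y\<^sup>2 \<le> 2 * real (card L)" by (simp add: y_def potential_def)
    then have "\<epsilon> * y\<^sup>2 \<le> \<epsilon> * (2 * real (card L))"
      using eps by (rule mult_left_mono)
    then have "\<epsilon> / 2 \<le> real (card L) * \<epsilon> / y\<^sup>2"
      using y by (subst pos_le_divide_eq) (auto simp: mult_ac)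
    then show ?thesis
      using False by simp
  qed
  finally show ?thesis
    by (simp add: y_def \<epsilon>_def)
qed

end

subsection \<open>The voter process\<close>

lemma finite_set_voter_hist [simp]: "finite (set_pmf (voter_hist n adv c0 t))"
  by (induction t) auto

lemma length_voter_hist: "h \<in> set_pmf (voter_hist n adv c0 t) \<Longrightarrow> length h = Suc t"
  by (induction t arbitrary: h) auto

lemma expectation_voter_hist_Suc:
  fixes F :: "(nat \<Rightarrow> nat) list \<Rightarrow> real"
  shows "measure_pmf.expectation (voter_hist n adv c0 (Suc t)) F =
    measure_pmf.expectation (voter_hist n adv c0 t)
      (\<lambda>h. measure_pmf.expectation (voter_step n (adv h) (last h)) (\<lambda>c. F (h @ [c])))"
  by (simp add: expectation_bind_pmf_finite)

lemma consensus_by_append: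
  "consensus_by n k h \<Longrightarrow> length h = Suc k \<Longrightarrow> consensus_by n (Suc k) (h @ [c])"
  by (fastforce simp: consensus_by_def nth_append)

lemma consensus_by_last:
  "consensus n (last h) \<Longrightarrow> length h = Suc k \<Longrightarrow> consensus_by n k h"
  by (cases "h = []") (auto simp: consensus_by_def last_conv_nth intro!: exI[of _ k])

locale voter_process =
  fixes n \<kappa> :: nat and d :: "nat \<Rightarrow> nat" and \<phi> :: "nat \<Rightarrow> real"
    and adv :: "(nat \<Rightarrow> nat) list \<Rightarrow> nat \<Rightarrow> nat \<Rightarrow> bool" and c0 :: "nat \<Rightarrow> nat"
  assumes kappa_le: "\<kappa> \<le> n" and init_range: "\<And>u. u \<in> verts n \<Longrightarrow> c0 u \<in> {1..\<kappa>}"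
    and phi_nonneg: "\<And>t. \<phi> t \<ge> 0" and admissible: "admissible_adversary n d \<phi> adv"
    and two_le: "n \<ge> 2"
begin

abbreviation "H \<equiv> voter_hist n adv c0"
abbreviation "W \<equiv> \<Sum>u\<in>verts n. d u"
text \<open>The probability of no consensus within \<open>k\<close> rounds, as an expectation so
  that it combines linearly with those of the potential.\<close>

abbreviation "q k \<equiv> measure_pmf.expectation (H k) (\<lambda>h. of_bool (\<not> consensus_by n k h) :: real)"

text \<open>A history of length \<open>Suc t\<close> includes the initial configuration, so it
  precedes round \<open>Suc t\<close>; hence the index of \<open>\<phi>\<close>.\<close>

lemma voter_round_adv:
  assumes "length h = Suc t" "last h ` verts n \<subseteq> {1..\<kappa>}"
  shows "voter_round n (adv h) d (\<phi> (Suc t)) \<kappa> (last h)"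
proof -
  have "is_graph n (adv h) \<and> connected_graph n (adv h) \<and>
      (\<forall>j\<in>verts n. deg n (adv h) j = d j) \<and> \<phi> (Suc t) \<le> conductance n (adv h)"
    using admissible[unfolded admissible_adversary_def, rule_format, of h] assms(1) by simp
  then show ?thesis
    using assms(2) two_le phi_nonneg[of "Suc t"] by unfold_locales auto
qed

lemma last_voter_hist_range:
  "h \<in> set_pmf (H t) \<Longrightarrow> last h ` verts n \<subseteq> {1..\<kappa>}"
proof (induction t arbitrary: h)
  case 0
  then show ?case using init_range by auto
next
  case (Suc t)
  then obtain g c where gc: "g \<in> set_pmf (H t)" "c \<in> set_pmf (voter_step n (adv g) (last g))" "h = g @ [c]"
    by auto
  then have "voter_round n (adv g) d (\<phi> (Suc t)) \<kappa> (last g)"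
    using Suc.IH length_voter_hist by (intro voter_round_adv) auto
  from voter_round.set_voter_step_range[OF this gc(2)] gc(3) show ?case by simp
qed

lemma voter_round_hist:
  "h \<in> set_pmf (H t) \<Longrightarrow> voter_round n (adv h) d (\<phi> (Suc t)) \<kappa> (last h)"
  by (rule voter_round_adv[OF length_voter_hist last_voter_hist_range])

lemma initial_round: "voter_round n (adv [c0]) d (\<phi> (Suc 0)) \<kappa> c0"
  using voter_round_hist[of "[c0]" 0] by simp

lemma q_Suc_le: "q (Suc k) \<le> q k"
  unfolding expectation_voter_hist_Suc
proof (rule expectation_mono_pmf_finite[OF finite_set_voter_hist])
  fix h assume h: "h \<in> set_pmf (H k)"
  have "measure_pmf.expectation (voter_step n (adv h) (last h))
      (\<lambda>c. of_bool (\<not> consensus_by n (Suc k) (h @ [c])) :: real) \<le>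
    measure_pmf.expectation (voter_step n (adv h) (last h)) (\<lambda>c. of_bool (\<not> consensus_by n k h))"
    using consensus_by_append[OF _ length_voter_hist[OF h]]
    by (intro expectation_mono_pmf_finite) auto
  then show "measure_pmf.expectation (voter_step n (adv h) (last h))
      (\<lambda>c. of_bool (\<not> consensus_by n (Suc k) (h @ [c])) :: real) \<le> of_bool (\<not> consensus_by n k h)"
    by simp
qed

lemma q_nonneg: "q k \<ge> 0"
  by (intro Bochner_Integration.integral_nonneg) auto

text \<open>Each round lowers the expectation by at least \<open>\<epsilon> * \<phi> t\<close> times
  the probability of no consensus before it. As \<open>q\<close> decreases, the final value
  \<open>q k\<close> may stand for all these probabilities.\<close>

lemma expectation_neg_inverse_potential_hist_le:
  defines "\<epsilon> \<equiv> real (Min (d ` verts n)) / (64 * real W)"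
  shows "measure_pmf.expectation (H k) (\<lambda>h. - 1 / potential n d \<kappa> (last h)) + q k * (\<epsilon> * (\<Sum>t=1..k. \<phi> t)) \<le> 0"
proof (induction k)
  case 0
  then show ?case
    using voter_round.potential_ge_one[OF initial_round] by simp
next
  case (Suc k)
  note [simp] = integrable_measure_pmf_finite[OF finite_set_voter_hist]
  have eps: "\<epsilon> \<ge> 0" unfolding \<epsilon>_def by (intro divide_nonneg_nonneg) linarith+
  let ?Y = "\<lambda>k. measure_pmf.expectation (H k) (\<lambda>h. - 1 / potential n d \<kappa> (last h))"
  have "?Y (Suc k) \<le> measure_pmf.expectation (H k)
      (\<lambda>h. - 1 / potential n d \<kappa> (last h) - of_bool (\<not> consensus_by n k h) * (\<epsilon> * \<phi> (Suc k)))"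
    unfolding expectation_voter_hist_Suc last_snoc
  proof (rule expectation_mono_pmf_finite[OF finite_set_voter_hist])
    fix h assume h: "h \<in> set_pmf (H k)"
    have "measure_pmf.expectation (voter_step n (adv h) (last h)) (\<lambda>c. - 1 / potential n d \<kappa> c) \<le>
      - 1 / potential n d \<kappa> (last h) - of_bool (\<not> consensus n (last h)) * (\<epsilon> * \<phi> (Suc k))"
      using voter_round.expectation_neg_inverse_potential_le[OF voter_round_hist[OF h]]
      by (simp add: \<epsilon>_def)
    \<comment> \<open>If no configuration so far is a consensus, neither is the last one.\<close>
    also have "\<dots> \<le> - 1 / potential n d \<kappa> (last h) - of_bool (\<not> consensus_by n k h) * (\<epsilon> * \<phi> (Suc k))"
      using consensus_by_last[OF _ length_voter_hist[OF h]] eps phi_nonneg[of "Suc k"]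
      by (intro diff_left_mono mult_right_mono) auto
    finally show "measure_pmf.expectation (voter_step n (adv h) (last h)) (\<lambda>c. - 1 / potential n d \<kappa> c) \<le>
      - 1 / potential n d \<kappa> (last h) - of_bool (\<not> consensus_by n k h) * (\<epsilon> * \<phi> (Suc k))" .
  qed
  also have "\<dots> = ?Y k - q k * (\<epsilon> * \<phi> (Suc k))"
    by (subst Bochner_Integration.integral_diff) auto
  finally have 1: "?Y (Suc k) \<le> ?Y k - q k * (\<epsilon> * \<phi> (Suc k))" .
  have 2: "q (Suc k) * (\<epsilon> * (\<Sum>t=1..Suc k. \<phi> t)) \<le> q k * (\<epsilon> * (\<Sum>t=1..Suc k. \<phi> t))"
    using q_Suc_le eps phi_nonneg by (intro mult_right_mono mult_nonneg_nonneg sum_nonneg) auto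
  have 3: "q k * (\<epsilon> * (\<Sum>t=1..Suc k. \<phi> t)) = q k * (\<epsilon> * (\<Sum>t=1..k. \<phi> t)) + q k * (\<epsilon> * \<phi> (Suc k))"
    by (simp add: algebra_simps)
  from Suc.IH 1 2 3 show ?case by linarith
qed

lemma q_le_half_of_sum:
  assumes "(\<Sum>t=1..k. \<phi> t) \<ge> 256 * (real W / 2) / real (Min (d ` verts n))"
  shows "q k \<le> 1/2"
proof -
  interpret R: voter_round n "adv [c0]" d "\<phi> (Suc 0)" \<kappa> c0
    by (rule initial_round)
  define \<delta> where "\<delta> = real (Min (d ` verts n))"
  define w where "w = real W"
  have "Min (d ` verts n) \<in> d ` verts n"
    using R.verts_nonempty by (intro Min_in) auto
  then have \<delta>: "\<delta> > 0" using R.d_pos by (auto simp: \<delta>_def)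
  have w: "w > 0" using R.W_pos unfolding w_def by linarith
  \<comment> \<open>The constant 256 makes this product 2; since the expectation of the inverse
    potential is at most 1, \<open>q k\<close> is at most 1/2.\<close>
  have "2 = \<delta> / (64 * w) * (256 * (w / 2) / \<delta>)"
    using \<delta> w by simp
  also have "\<dots> \<le> \<delta> / (64 * w) * (\<Sum>t=1..k. \<phi> t)"
    using assms \<delta> w by (intro mult_left_mono) (auto simp: \<delta>_def w_def)
  finally have "q k * 2 \<le> q k * (\<delta> / (64 * w) * (\<Sum>t=1..k. \<phi> t))"
    using q_nonneg by (intro mult_left_mono) auto
  also have "\<dots> \<le> measure_pmf.expectation (H k) (\<lambda>h. 1 / potential n d \<kappa> (last h))"
    using expectation_neg_inverse_potential_hist_le[of k] by (simp add: \<delta>_def w_def)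
  also have "\<dots> \<le> measure_pmf.expectation (H k) (\<lambda>h. 1)"
  proof (rule expectation_mono_pmf_finite[OF finite_set_voter_hist])
    fix h assume "h \<in> set_pmf (H k)"
    from voter_round.potential_ge_one[OF voter_round_hist[OF this]]
    show "1 / potential n d \<kappa> (last h) \<le> 1" by simp
  qed
  finally show ?thesis by simp
qed

text \<open>Iterates the contraction with \<open>1 - x \<le> exp (- x)\<close>, starting from a
  potential of at most \<open>\<kappa> \<le> n\<close>.\<close>

lemma expectation_potential_hist_le:
  "measure_pmf.expectation (H k) (\<lambda>h. potential n d \<kappa> (last h) - 1) \<le>
    exp (- (\<Sum>t=1..k. (\<phi> t)\<^sup>2) / (32 * real n)) * real n"
proof (induction k)
  case 0
  have "potential n d \<kappa> c0 \<le> real n"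
    using voter_round.potential_le[OF initial_round] kappa_le by linarith
  then show ?case by simp
next
  case (Suc k)
  note [simp] = integrable_measure_pmf_finite[OF finite_set_voter_hist]
    integrable_measure_pmf_finite[OF finite_set_voter_step]
  let ?a = "(\<phi> (Suc k))\<^sup>2 / (32 * real n)"
  have "measure_pmf.expectation (H (Suc k)) (\<lambda>h. potential n d \<kappa> (last h) - 1) \<le>
    measure_pmf.expectation (H k) (\<lambda>h. exp (- ?a) * (potential n d \<kappa> (last h) - 1))"
    unfolding expectation_voter_hist_Suc last_snoc
  proof (rule expectation_mono_pmf_finite[OF finite_set_voter_hist])
    fix h assume h: "h \<in> set_pmf (H k)"
    interpret R: voter_round n "adv h" d "\<phi> (Suc k)" \<kappa> "last h"
      by (rule voter_round_hist[OF h])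
    have "measure_pmf.expectation (voter_step n (adv h) (last h)) (\<lambda>c. potential n d \<kappa> c - 1) \<le>
      (1 - ?a) * (potential n d \<kappa> (last h) - 1)"
      using R.expectation_potential_le_quadratic by simp
    also have "\<dots> \<le> exp (- ?a) * (potential n d \<kappa> (last h) - 1)"
      using exp_ge_add_one_self[of "- ?a"] R.potential_ge_one by (intro mult_right_mono) auto
    finally show "measure_pmf.expectation (voter_step n (adv h) (last h)) (\<lambda>c. potential n d \<kappa> c - 1) \<le>
      exp (- ?a) * (potential n d \<kappa> (last h) - 1)" .
  qed
  also have "\<dots> = exp (- ?a) * measure_pmf.expectation (H k) (\<lambda>h. potential n d \<kappa> (last h) - 1)"
    by (rule Bochner_Integration.integral_mult_right) simp
  also have "\<dots> \<le> exp (- ?a) * (exp (- (\<Sum>t=1..k. (\<phi> t)\<^sup>2) / (32 * real n)) * real n)"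
    by (intro mult_left_mono Suc.IH) auto
  also have "\<dots> = exp (- (\<Sum>t=1..Suc k. (\<phi> t)\<^sup>2) / (32 * real n)) * real n"
    by (simp add: exp_add[symmetric] mult.assoc[symmetric] add_divide_distrib diff_divide_distrib add.commute)
  finally show ?case .
qed

lemma q_le_half_of_sum_squares:
  assumes "(\<Sum>t=1..k. (\<phi> t)\<^sup>2) \<ge> 256 * real n * ln (real n)"
  shows "q k \<le> 1/2"
proof -
  note [simp] = integrable_measure_pmf_finite[OF finite_set_voter_hist]
  have n: "real n \<ge> 2" using two_le by simp
  \<comment> \<open>Markov's inequality, obtained by bounding the indicator pointwise by the scaled
    potential.\<close>
  have "q k \<le> measure_pmf.expectation (H k) (\<lambda>h. 4 * real n * (potential n d \<kappa> (last h) - 1))"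
  proof (rule expectation_mono_pmf_finite[OF finite_set_voter_hist])
    fix h assume h: "h \<in> set_pmf (H k)"
    interpret R: voter_round n "adv h" d "\<phi> (Suc k)" \<kappa> "last h"
      by (rule voter_round_hist[OF h])
    show "of_bool (\<not> consensus_by n k h) \<le> 4 * real n * (potential n d \<kappa> (last h) - 1)"
    proof (cases "consensus_by n k h")
      case True
      then show ?thesis using R.potential_ge_one by simp
    next
      case False
      then have "\<not> consensus n (last h)"
        using consensus_by_last length_voter_hist[OF h] by blast
      from R.potential_minus_one_ge[OF this] show ?thesis
        using False n by (simp add: field_simps)
    qed
  qed
  also have "\<dots> = 4 * real n * measure_pmf.expectation (H k) (\<lambda>h. potential n d \<kappa> (last h) - 1)"
    by (rule Bochner_Integration.integral_mult_right) simp
  also have "\<dots> \<le> 4 * real n * (exp (- (\<Sum>t=1..k. (\<phi> t)\<^sup>2) / (32 * real n)) * real n)"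
    by (intro mult_left_mono expectation_potential_hist_le) auto
  \<comment> \<open>The exponent is 256 / 32 = 8, so the bound becomes \<open>4 / n ^ 6\<close>,
    which is at most 1/16.\<close>
  also have "\<dots> \<le> 4 * real n * (exp (- (8 * ln (real n))) * real n)"
    using assms n by (intro mult_left_mono mult_right_mono) (auto simp: field_simps)
  also have "exp (- (8 * ln (real n))) = 1 / real n ^ 8"
  proof -
    have "exp (8 * ln (real n)) = real n ^ 8"
      using n exp_of_nat_mult[of 8 "ln (real n)"] by simp
    then show ?thesis by (simp add: exp_minus inverse_eq_divide)
  qed
  also have "4 * real n * (1 / real n ^ 8 * real n) = 4 / real n ^ 6"
    using n by (simp add: field_simps eval_nat_numeral)
  also have "\<dots> \<le> 4 / 2 ^ 6"
    using n by (intro divide_left_mono power_mono) auto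
  finally show ?thesis by simp
qed

lemma prob_consensus_by: "measure_pmf.prob (H k) {h. consensus_by n k h} = 1 - q k"
proof -
  have "q k = measure_pmf.expectation (H k) (indicator {h. \<not> consensus_by n k h})"
    by (intro Bochner_Integration.integral_cong) (auto simp: indicator_def)
  also have "\<dots> = measure_pmf.prob (H k) (UNIV - {h. consensus_by n k h})"
    by (simp add: Compl_eq_Diff_UNIV[symmetric] Collect_neg_eq)
  also have "\<dots> = 1 - measure_pmf.prob (H k) {h. consensus_by n k h}"
    using measure_pmf.prob_compl[of "{h. consensus_by n k h}" "H k"] by simp
  finally show ?thesis by simp
qed

end

lemma consensus_trivial: "n < 2 \<Longrightarrow> consensus n c"
  by (auto simp: consensus_def verts_def less_2_cases_iff)

text \<open>Any \<open>k\<close> reaching one of the two thresholds is covered, in particular the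
  smaller of the two first such rounds. Half the degree sum stands for the number of edges, and a
  constant sequence \<open>\<phi>\<close> gives the static case.\<close>

theorem theorem1:
  "\<exists>b::real. b > 0 \<and>
    (\<forall>(n::nat) (\<kappa>::nat) (d::nat \<Rightarrow> nat) (\<phi>::nat \<Rightarrow> real) adv (c0::nat \<Rightarrow> nat) (k::nat).
       \<kappa> \<le> n \<longrightarrow>
       (\<forall>u\<in>verts n. c0 u \<in> {1..\<kappa>}) \<longrightarrow>
       (\<forall>t. \<phi> t \<ge> 0) \<longrightarrow>
       admissible_adversary n d \<phi> adv \<longrightarrow>
       ((\<Sum>t=1..k. \<phi> t) \<ge> b * (real (\<Sum>j\<in>verts n. d j) / 2) / real (Min (d ` verts n))
        \<or> (\<Sum>t=1..k. (\<phi> t)\<^sup>2) \<ge> b * real n * ln (real n)) \<longrightarrow>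
       measure_pmf.prob (voter_hist n adv c0 k) {h. consensus_by n k h} \<ge> 1/2)"
proof (intro exI[of _ 256] conjI allI impI)
  fix n \<kappa> k :: nat and d c0 :: "nat \<Rightarrow> nat" and \<phi> :: "nat \<Rightarrow> real" and adv
  assume *: "\<kappa> \<le> n" "\<forall>u\<in>verts n. c0 u \<in> {1..\<kappa>}" "\<forall>t. \<phi> t \<ge> 0" "admissible_adversary n d \<phi> adv"
    and sums: "(\<Sum>t=1..k. \<phi> t) \<ge> 256 * (real (\<Sum>j\<in>verts n. d j) / 2) / real (Min (d ` verts n))
      \<or> (\<Sum>t=1..k. (\<phi> t)\<^sup>2) \<ge> 256 * real n * ln (real n)"
  show "measure_pmf.prob (voter_hist n adv c0 k) {h. consensus_by n k h} \<ge> 1/2"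
  proof (cases "n < 2")
    case True
    \<comment> \<open>With at most one node, the initial configuration is already a consensus; for
      larger \<open>n\<close> all degrees are positive and the process locale applies.\<close>
    then have "{h. consensus_by n k h} = UNIV"
      using consensus_trivial by (auto simp: consensus_by_def)
    then show ?thesis by simp
  next
    case False
    then interpret voter_process n \<kappa> d \<phi> adv c0
      using * by unfold_locales auto
    from sums have "q k \<le> 1/2"
      using q_le_half_of_sum q_le_half_of_sum_squares by blast
    then show ?thesis
      unfolding prob_consensus_by by simp
  qed
qed simp

end
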